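(* Let $m,n\ge1$ and $r\ge1$ be integers. The ordinary center $\mathscr{Z}(\mathcal{S}_v(m|n,r))$ of the superalgebra $\mathcal{S}_v(m|n,r)$ consists only of even elements. Consequently $\mathscr{Z}_{\mathrm{s}}(\mathcal{S}_v(m|n,r))=\mathscr{Z}(\mathcal{S}_v(m|n,r))$.
   Context: For an associative superalgebra $\mathscr{A}$ the ordinary center is $\mathscr{Z}(\mathscr{A})=\{z\in\mathscr{A}\mid za=az\ \forall a\in\mathscr{A}\}$, and the supercenter is $\mathscr{Z}_{\mathrm{s}}(\mathscr{A})=\mathscr{Z}_{\mathrm{s}}(\mathscr{A})_{\bar0}\oplus\mathscr{Z}_{\mathrm{s}}(\mathscr{A})_{\bar1}$ with $\mathscr{Z}_{\mathrm{s}}(\mathscr{A})_{\bar i}=\{z\in\mathscr{A}_{\bar i}\mid za=(-1)^{\bar i\bar a}az\text{ for all homogeneous }a\in\mathscr{A}\}$, where $\bar a\in\mathbb{Z}_2$ denotes the parity of $a$. Quantum Schur superalgebra: let $v$ be an indeterminate. For $1\le a\le m+n$ put $\bar a=\bar 0$ if $a\le m$, $\bar a=\bar 1$ if $a>m$, and $v_a=v^{(-1)^{\bar a}}$. Let $V_v$ be the $\mathbb{C}(v)$-superspace with basis $e_1,\dots,e_{m+n}$, $e_a$ of parity $\bar a$. The quantum supergroup $U_v(\mathfrak{gl}_{m|n})$ has generators $\mathsf{E}_a,\mathsf{F}_a$ ($1\le a<m+n$), $\mathsf{K}_j^{\pm1}$ ($1\le j\le m+n$), with only $\mathsf{E}_m,\mathsf{F}_m$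 odd, acting on $V_v$ by $\mathsf{K}_a e_b=v_a^{\delta_{a,b}}e_b$, $\mathsf{E}_a e_b=\delta_{a+1,b}e_a$, $\mathsf{F}_a e_b=\delta_{a,b}e_{a+1}$. It acts on $V_v^{\otimes r}$ through the comultiplication $\Delta(\mathsf{E}_a)=\mathsf{E}_a\otimes \mathsf{K}_a^{-1}\mathsf{K}_{a+1}+1\otimes \mathsf{E}_a$, $\Delta(\mathsf{F}_a)=\mathsf{F}_a\otimes 1+\mathsf{K}_a\mathsf{K}_{a+1}^{-1}\otimes \mathsf{F}_a$, $\Delta(\mathsf{K}_a)=\mathsf{K}_a\otimes \mathsf{K}_a$, with the super sign rule $(f\otimes g)(x\otimes y)=(-1)^{\bar g\bar x}fx\otimes gy$. $\mathcal{S}_v(m|n,r)$ is the image of $U_v(\mathfrak{gl}_{m|n})$ in $\mathrm{End}_{\mathbb{C}(v)}(V_v^{\otimes r})$, i.e. the subalgebra generated by the operators by which $\mathsf{E}_a,\mathsf{F}_a,\mathsf{K}_j^{\pm1}$ act, with the induced $\mathbb{Z}_2$-grading. *)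

theory Defs
  imports
    Complex_Main
    "HOL-Library.FuncSet"
    "HOL-Library.Z2"
    "HOL-Computational_Algebra.Polynomial"
    "HOL-Computational_Algebra.Fraction_Field"
    "HOL-Algebra.Module"
begin

section \<open>Associative superalgebras, center and supercenter\<close>

text \<open>
  The group \<open>\<int>\<^sub>2\<close> of parities is the type \<^typ>\<open>bit\<close>. Scalars form a type of class field
  rather than a ring record. The field \<open>hpart\<close> assigns to a parity the corresponding
  homogeneous component.
\<close>

definition par_sign :: "bit \<Rightarrow> 'k :: ring_1" where
  "par_sign i = (if i = 0 then 1 else - 1)"

record ('k, 'a) superalgebra = "('k, 'a) module" +
  hpart :: "bit \<Rightarrow> 'a set"

definition alg_center :: "('k, 'a, 'x) superalgebra_scheme \<Rightarrow> 'a set" where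
  "alg_center A = {z \<in> carrier A. \<forall>a \<in> carrier A. z \<otimes>\<^bsub>A\<^esub> a = a \<otimes>\<^bsub>A\<^esub> z}"

definition supercenter_part :: "('k :: field, 'a, 'x) superalgebra_scheme \<Rightarrow> bit \<Rightarrow> 'a set" where
  "supercenter_part A i =
     {z \<in> hpart A i. \<forall>j. \<forall>a \<in> hpart A j. z \<otimes>\<^bsub>A\<^esub> a = par_sign (i * j) \<odot>\<^bsub>A\<^esub> (a \<otimes>\<^bsub>A\<^esub> z)}"

definition supercenter :: "('k :: field, 'a, 'x) superalgebra_scheme \<Rightarrow> 'a set" where
  "supercenter A =
     {z0 \<oplus>\<^bsub>A\<^esub> z1 |z0 z1. z0 \<in> supercenter_part A 0 \<and> z1 \<in> supercenter_part A 1}"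

text \<open>The underlying set of the unital subalgebra generated by \<open>G\<close>.\<close>

inductive_set subalgebra_gen :: "('k :: field, 'a, 'x) superalgebra_scheme \<Rightarrow> 'a set \<Rightarrow> 'a set"
  for A G where
  gen: "g \<in> G \<Longrightarrow> g \<in> subalgebra_gen A G"
| one: "\<one>\<^bsub>A\<^esub> \<in> subalgebra_gen A G"
| smult: "x \<in> subalgebra_gen A G \<Longrightarrow> c \<odot>\<^bsub>A\<^esub> x \<in> subalgebra_gen A G"
| add: "x \<in> subalgebra_gen A G \<Longrightarrow> y \<in> subalgebra_gen A G \<Longrightarrow> x \<oplus>\<^bsub>A\<^esub> y \<in> subalgebra_gen A G"
| mult: "x \<in> subalgebra_gen A G \<Longrightarrow> y \<in> subalgebra_gen A G \<Longrightarrow> x \<otimes>\<^bsub>A\<^esub> y \<in> subalgebra_gen A G"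


section \<open>The tensor superspace\<close>

type_synonym Cv = "complex poly fract"

definition vv :: Cv where
  "vv = Fraction_Field.Fract [:0, 1:] 1"

text \<open>
  The basis vector \<open>e\<^bsub>b1\<^esub> \<otimes> \<dots> \<otimes> e\<^bsub>br\<^esub>\<close> of the \<open>r\<close>-th tensor power of \<open>V\<^sub>v\<close> is indexed by the
  word \<open>[b1, \<dots>, br]\<close>, and a tensor is its coefficient function, which vanishes at all
  other words. Thus \<open>V\<^sub>v\<close> itself is the case of words of length one.
\<close>

type_synonym tensor = "nat list \<Rightarrow> Cv"
type_synonym tensor_op = "tensor \<Rightarrow> tensor"

definition basis_tensor :: "nat list \<Rightarrow> tensor" where
  "basis_tensor w = (\<lambda>u. if u = w then 1 else 0)"

definition tensor_vec :: "tensor \<Rightarrow> tensor \<Rightarrow> tensor" where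
  "tensor_vec x y = (\<lambda>u. case u of [] \<Rightarrow> 0 | a # u' \<Rightarrow> x [a] * y u')"

text \<open>The generators \<open>E\<^sub>a\<close>, \<open>F\<^sub>a\<close>, \<open>K\<^sub>j\<close> and the inverse of \<open>K\<^sub>j\<close>.\<close>

datatype qgen = E nat | F nat | K nat | Kinv nat

context
  fixes m n :: nat
begin

definition par :: "nat \<Rightarrow> bit" where
  "par a = (if a \<le> m then 0 else 1)"

definition word_par :: "nat list \<Rightarrow> bit" where
  "word_par w = (\<Sum>a\<leftarrow>w. par a)"

definition vpar :: "nat \<Rightarrow> Cv" where
  "vpar a = (if a \<le> m then vv else inverse vv)"

definition words :: "nat \<Rightarrow> nat list set" where
  "words r = {w. length w = r \<and> set w \<subseteq> {1..m + n}}"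

definition tensor_space :: "nat \<Rightarrow> tensor set" where
  "tensor_space r = {x. \<forall>w. w \<notin> words r \<longrightarrow> x w = 0}"

definition tensor_space_part :: "nat \<Rightarrow> bit \<Rightarrow> tensor set" where
  "tensor_space_part r i = {x \<in> tensor_space r. \<forall>w. x w \<noteq> 0 \<longrightarrow> word_par w = i}"

definition lin_ext :: "nat \<Rightarrow> (nat list \<Rightarrow> tensor) \<Rightarrow> tensor_op" where
  "lin_ext r h = (\<lambda>x \<in> tensor_space r. \<lambda>u. \<Sum>w \<in> words r. x w * h w u)"


subsection \<open>The superalgebra of endomorphisms\<close>

text \<open>
  To make equality of operators extensional, they are undefined outside \<open>tensor_space r\<close>.
\<close>

definition End_carrier :: "nat \<Rightarrow> tensor_op set" where
  "End_carrier r =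
     {f \<in> tensor_space r \<rightarrow>\<^sub>E tensor_space r.
        (\<forall>x \<in> tensor_space r. \<forall>y \<in> tensor_space r. f (\<lambda>w. x w + y w) = (\<lambda>w. f x w + f y w)) \<and>
        (\<forall>c. \<forall>x \<in> tensor_space r. f (\<lambda>w. c * x w) = (\<lambda>w. c * f x w))}"

definition End_alg :: "nat \<Rightarrow> (Cv, tensor_op) superalgebra" where
  "End_alg r =
     \<lparr>carrier = End_carrier r,
      mult = compose (tensor_space r),
      one = (\<lambda>x \<in> tensor_space r. x),
      zero = (\<lambda>x \<in> tensor_space r. \<lambda>w. 0),
      add = (\<lambda>f g. \<lambda>x \<in> tensor_space r. \<lambda>w. f x w + g x w),
      smult = (\<lambda>c f. \<lambda>x \<in> tensor_space r. \<lambda>w. c * f x w),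
      hpart = (\<lambda>i. {f \<in> End_carrier r.
                 \<forall>j. \<forall>x \<in> tensor_space_part r j. f x \<in> tensor_space_part r (i + j)})\<rparr>"

text \<open>
  The operator \<open>f \<otimes> g\<close> for an operator \<open>f\<close> on \<open>V\<^sub>v\<close> and an operator \<open>g\<close>, homogeneous of
  parity \<open>p\<close>, on the \<open>r\<close>-th tensor power. It maps \<open>e\<^sub>a \<otimes> y\<close> to
  \<open>(-1)\<^bsup>p * par a\<^esup> f e\<^sub>a \<otimes> g y\<close>.
\<close>

definition tensor_opr :: "nat \<Rightarrow> bit \<Rightarrow> tensor_op \<Rightarrow> tensor_op \<Rightarrow> tensor_op" where
  "tensor_opr r p f g =
     lin_ext (Suc r) (\<lambda>w u. par_sign (p * par (hd w)) *
        tensor_vec (f (basis_tensor [hd w])) (g (basis_tensor (tl w))) u)"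


subsection \<open>The action of the quantum supergroup\<close>

fun gen_par :: "qgen \<Rightarrow> bit" where
  "gen_par (E a) = (if a = m then 1 else 0)"
| "gen_par (F a) = (if a = m then 1 else 0)"
| "gen_par (K a) = 0"
| "gen_par (Kinv a) = 0"

text \<open>The image of \<open>e\<^sub>b\<close> under a generator.\<close>

fun vec_act :: "qgen \<Rightarrow> nat \<Rightarrow> tensor" where
  "vec_act (E a) b = (if b = a + 1 then basis_tensor [a] else (\<lambda>w. 0))"
| "vec_act (F a) b = (if b = a then basis_tensor [a + 1] else (\<lambda>w. 0))"
| "vec_act (K a) b = (\<lambda>w. (if b = a then vpar a else 1) * basis_tensor [b] w)"
| "vec_act (Kinv a) b = (\<lambda>w. (if b = a then inverse (vpar a) else 1) * basis_tensor [b] w)"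

definition act1 :: "qgen \<Rightarrow> tensor_op" where
  "act1 g = lin_ext 1 (\<lambda>w. vec_act g (hd w))"

text \<open>
  The \<open>r\<close>-th tensor power is \<open>V\<^sub>v\<close> tensored with the \<open>(r-1)\<close>-st; by coassociativity the
  bracketing is immaterial. For \<open>r = 0\<close> the action is the trivial one, through the counit.
\<close>

fun act :: "nat \<Rightarrow> qgen \<Rightarrow> tensor_op" where
  "act 0 (E a) = \<zero>\<^bsub>End_alg 0\<^esub>"
| "act 0 (F a) = \<zero>\<^bsub>End_alg 0\<^esub>"
| "act 0 (K a) = \<one>\<^bsub>End_alg 0\<^esub>"
| "act 0 (Kinv a) = \<one>\<^bsub>End_alg 0\<^esub>"
| "act (Suc 0) g = act1 g"
| "act (Suc (Suc r)) (E a) =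
     tensor_opr (Suc r) 0 (act1 (E a))
       (act (Suc r) (Kinv a) \<otimes>\<^bsub>End_alg (Suc r)\<^esub> act (Suc r) (K (a + 1)))
     \<oplus>\<^bsub>End_alg (Suc (Suc r))\<^esub>
     tensor_opr (Suc r) (gen_par (E a)) \<one>\<^bsub>End_alg 1\<^esub> (act (Suc r) (E a))"
| "act (Suc (Suc r)) (F a) =
     tensor_opr (Suc r) 0 (act1 (F a)) \<one>\<^bsub>End_alg (Suc r)\<^esub>
     \<oplus>\<^bsub>End_alg (Suc (Suc r))\<^esub>
     tensor_opr (Suc r) (gen_par (F a)) (act1 (K a) \<otimes>\<^bsub>End_alg 1\<^esub> act1 (Kinv (a + 1)))
       (act (Suc r) (F a))"
| "act (Suc (Suc r)) (K a) = tensor_opr (Suc r) 0 (act1 (K a)) (act (Suc r) (K a))"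
| "act (Suc (Suc r)) (Kinv a) = tensor_opr (Suc r) 0 (act1 (Kinv a)) (act (Suc r) (Kinv a))"

definition generators :: "qgen set" where
  "generators =
     E ` {a. 1 \<le> a \<and> a < m + n} \<union> F ` {a. 1 \<le> a \<and> a < m + n} \<union> K ` {1..m + n} \<union> Kinv ` {1..m + n}"

text \<open>The quantum Schur superalgebra, with the operations and the grading of \<^const>\<open>End_alg\<close>.\<close>

definition schur_superalgebra :: "nat \<Rightarrow> (Cv, tensor_op) superalgebra" where
  "schur_superalgebra r =
     (End_alg r)
       \<lparr>carrier := subalgebra_gen (End_alg r) (act r ` generators),
        hpart := (\<lambda>i. hpart (End_alg r) i \<inter> subalgebra_gen (End_alg r) (act r ` generators))\<rparr>"

end

end

theory Submission
  imports Defs "HOL-Library.Multiset"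
begin

text \<open>
  The element \<open>K\<^sub>a\<close> multiplies the basis tensor of a word by the scalar \<open>v\<^sub>a\<close> raised to the number of
  occurrences of the letter \<open>a\<close>. Since \<open>v\<^sub>a\<close> is not a root of unity, the simultaneous eigenspaces of
  \<open>K\<^sub>1, \<dots>, K\<^bsub>m+n\<^esub>\<close> are exactly the weight spaces, each spanned by the rearrangements of one word.
  The parity of a word is the number of its letters above \<open>m\<close> modulo two, hence constant on a weight
  space. An operator that commutes with all \<open>K\<^sub>a\<close> preserves the weight spaces and is
  therefore even (\<open>even_if_commutes_with_K\<close>). This applies to every central element.

  It applies to odd supercentral elements as well: the \<open>K\<^sub>a\<close> are even, so no sign arises when these
  elements are moved past them. Being both even and odd they vanish
  (\<open>supercenter_odd_part\<close>). An even supercentral element commutes with all homogeneous elements in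
  the ordinary sense, in particular with the generators, which are homogeneous (\<open>act_hpart\<close>), and
  hence with the algebra that they generate (\<open>supercenter_even_part\<close>). So the supercenter is its
  even part, and this is the center.
\<close>

text \<open>The simplifier would otherwise turn sums of parities into conditions on their summands.\<close>

declare add_bit_eq_xor [simp del]

section \<open>Linear operators on the tensor space\<close>

lemma finite_words: "finite (words m n r)"
proof -
  have "words m n r = {w. set w \<subseteq> {1..m + n} \<and> length w = r}"
    by (auto simp: words_def)
  then show ?thesis by (simp add: finite_lists_length_eq)
qed

lemma tensor_space_add:
  "x \<in> tensor_space m n r \<Longrightarrow> y \<in> tensor_space m n r \<Longrightarrow> (\<lambda>w. x w + y w) \<in> tensor_space m n r"
  by (auto simp: tensor_space_def)

lemma tensor_space_scale:
  "x \<in> tensor_space m n r \<Longrightarrow> (\<lambda>w. c * x w) \<in> tensor_space m n r"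
  by (auto simp: tensor_space_def)

lemma tensor_space_zero: "(\<lambda>w. 0) \<in> tensor_space m n r"
  by (auto simp: tensor_space_def)

lemma tensor_space_sum:
  "(\<And>w. w \<in> S \<Longrightarrow> h w \<in> tensor_space m n r) \<Longrightarrow>
    (\<lambda>u. \<Sum>w\<in>S. c w * h w u) \<in> tensor_space m n r"
  by (auto simp: tensor_space_def)

lemma tensor_space_partD: "x \<in> tensor_space_part m n r i \<Longrightarrow> x \<in> tensor_space m n r"
  by (auto simp: tensor_space_part_def)

lemma tensor_space_part_add:
  "x \<in> tensor_space_part m n r i \<Longrightarrow> y \<in> tensor_space_part m n r i \<Longrightarrow>
    (\<lambda>w. x w + y w) \<in> tensor_space_part m n r i"
  by (auto simp: tensor_space_part_def intro: tensor_space_add) (metis add_0)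

lemma tensor_space_part_scale:
  "x \<in> tensor_space_part m n r i \<Longrightarrow> (\<lambda>w. c * x w) \<in> tensor_space_part m n r i"
  by (auto simp: tensor_space_part_def intro: tensor_space_scale)

lemma tensor_space_part_zero: "(\<lambda>w. 0) \<in> tensor_space_part m n r i"
  by (auto simp: tensor_space_part_def tensor_space_zero)

lemma basis_tensor_part:
  "w \<in> words m n r \<Longrightarrow> basis_tensor w \<in> tensor_space_part m n r (word_par m w)"
  by (auto simp: tensor_space_part_def tensor_space_def basis_tensor_def)

lemma basis_tensor_space: "w \<in> words m n r \<Longrightarrow> basis_tensor w \<in> tensor_space m n r"
  using basis_tensor_part tensor_space_partD by blast

lemma End_carrier_maps:
  "f \<in> End_carrier m n r \<Longrightarrow> x \<in> tensor_space m n r \<Longrightarrow> f x \<in> tensor_space m n r"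
  by (auto simp: End_carrier_def)

lemma End_carrier_add:
  "f \<in> End_carrier m n r \<Longrightarrow> x \<in> tensor_space m n r \<Longrightarrow> y \<in> tensor_space m n r \<Longrightarrow>
    f (\<lambda>w. x w + y w) = (\<lambda>w. f x w + f y w)"
  by (auto simp: End_carrier_def)

lemma End_carrier_scale:
  "f \<in> End_carrier m n r \<Longrightarrow> x \<in> tensor_space m n r \<Longrightarrow>
    f (\<lambda>w. c * x w) = (\<lambda>w. c * f x w)"
  by (auto simp: End_carrier_def)

lemma End_carrier_extensional:
  "f \<in> End_carrier m n r \<Longrightarrow> f \<in> extensional (tensor_space m n r)"
  by (auto simp: End_carrier_def PiE_def)

lemma End_carrierI:
  assumes "f \<in> extensional (tensor_space m n r)"
    and "\<And>x. x \<in> tensor_space m n r \<Longrightarrow> f x \<in> tensor_space m n r"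
    and "\<And>x y. x \<in> tensor_space m n r \<Longrightarrow> y \<in> tensor_space m n r \<Longrightarrow>
      f (\<lambda>w. x w + y w) = (\<lambda>w. f x w + f y w)"
    and "\<And>c x. x \<in> tensor_space m n r \<Longrightarrow> f (\<lambda>w. c * x w) = (\<lambda>w. c * f x w)"
  shows "f \<in> End_carrier m n r"
  using assms by (auto simp: End_carrier_def PiE_def)

lemma End_carrier_eqI:
  assumes "f \<in> End_carrier m n r" "g \<in> End_carrier m n r"
    and "\<And>x. x \<in> tensor_space m n r \<Longrightarrow> f x = g x"
  shows "f = g"
  using assms by (meson End_carrier_extensional extensionalityI)

text \<open>
  Linearity is given for two summands only; induction over sets of words extends it to the
  expansion of a tensor in basis tensors.
\<close>

lemma End_carrier_expand:
  assumes f: "f \<in> End_carrier m n r" and x: "x \<in> tensor_space m n r"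
  shows "f x = (\<lambda>u. \<Sum>w\<in>words m n r. x w * f (basis_tensor w) u)"
proof -
  have zero: "f (\<lambda>u. 0) = (\<lambda>u. 0)"
    using End_carrier_scale[OF f x, of 0] by simp
  have "f (\<lambda>u. \<Sum>w\<in>S. x w * basis_tensor w u) = (\<lambda>u. \<Sum>w\<in>S. x w * f (basis_tensor w) u)"
    if "finite S" "S \<subseteq> words m n r" for S
    using that
  proof (induction S)
    case empty
    then show ?case using zero by simp
  next
    case (insert w S)
    have 1: "basis_tensor w \<in> tensor_space m n r"
      using insert by (auto intro: basis_tensor_space)
    have 2: "(\<lambda>u. \<Sum>w\<in>S. x w * basis_tensor w u) \<in> tensor_space m n r"
      using insert by (intro tensor_space_sum basis_tensor_space) auto
    show ?case
      using insert End_carrier_add[OF f tensor_space_scale[OF 1, of "x w"] 2]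
        End_carrier_scale[OF f 1, of "x w"] by simp
  qed
  from this[OF finite_words subset_refl]
  have "f (\<lambda>u. \<Sum>w\<in>words m n r. x w * basis_tensor w u)
      = (\<lambda>u. \<Sum>w\<in>words m n r. x w * f (basis_tensor w) u)" .
  moreover have "(\<lambda>u. \<Sum>w\<in>words m n r. x w * basis_tensor w u) = x"
    using x by (auto simp: tensor_space_def basis_tensor_def finite_words if_distrib cong: if_cong)
  ultimately show ?thesis by simp
qed

lemma End_carrier_one: "(\<lambda>x\<in>tensor_space m n r. x) \<in> End_carrier m n r"
  by (rule End_carrierI) (auto simp: tensor_space_add tensor_space_scale)

lemma End_carrier_zero: "(\<lambda>x\<in>tensor_space m n r. \<lambda>w. 0) \<in> End_carrier m n r"
  by (rule End_carrierI) (auto simp: tensor_space_add tensor_space_scale tensor_space_zero)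

lemma End_carrier_plus:
  "f \<in> End_carrier m n r \<Longrightarrow> g \<in> End_carrier m n r \<Longrightarrow>
    (\<lambda>x\<in>tensor_space m n r. \<lambda>w. f x w + g x w) \<in> End_carrier m n r"
  by (rule End_carrierI)
     (auto simp: tensor_space_add tensor_space_scale End_carrier_maps End_carrier_add
        End_carrier_scale algebra_simps)

lemma End_carrier_smult:
  "f \<in> End_carrier m n r \<Longrightarrow>
    (\<lambda>x\<in>tensor_space m n r. \<lambda>w. c * f x w) \<in> End_carrier m n r"
  by (rule End_carrierI)
     (auto simp: tensor_space_add tensor_space_scale End_carrier_maps End_carrier_add
        End_carrier_scale algebra_simps)

lemma End_carrier_compose:
  "f \<in> End_carrier m n r \<Longrightarrow> g \<in> End_carrier m n r \<Longrightarrow>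
    compose (tensor_space m n r) f g \<in> End_carrier m n r"
  by (rule End_carrierI)
     (auto simp: tensor_space_add tensor_space_scale End_carrier_maps End_carrier_add
        End_carrier_scale compose_def)

lemma hpart_End_alg:
  "hpart (End_alg m n r) i = {f \<in> End_carrier m n r.
     \<forall>j. \<forall>x \<in> tensor_space_part m n r j. f x \<in> tensor_space_part m n r (i + j)}"
  by (simp add: End_alg_def)

lemma hpart_carrier: "f \<in> hpart (End_alg m n r) i \<Longrightarrow> f \<in> End_carrier m n r"
  by (simp add: hpart_End_alg)

lemma hpart_maps:
  "f \<in> hpart (End_alg m n r) i \<Longrightarrow> x \<in> tensor_space_part m n r j \<Longrightarrow>
    f x \<in> tensor_space_part m n r (i + j)"
  by (simp add: hpart_End_alg)

text \<open>
  If a word \<open>u\<close> occurs in \<open>f x\<close>, it occurs in the image of some basis tensor that occurs in \<open>x\<close>, so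
  parities need to be compared on basis tensors only.
\<close>

lemma hpartI_basis:
  assumes f: "f \<in> End_carrier m n r"
    and "\<And>w. w \<in> words m n r \<Longrightarrow> f (basis_tensor w) \<in> tensor_space_part m n r (i + word_par m w)"
  shows "f \<in> hpart (End_alg m n r) i"
proof -
  have "f x \<in> tensor_space_part m n r (i + j)" if x: "x \<in> tensor_space_part m n r j" for x j
  proof -
    have "word_par m u = i + j" if "f x u \<noteq> 0" for u
    proof -
      have "(\<Sum>w\<in>words m n r. x w * f (basis_tensor w) u) \<noteq> 0"
        using that End_carrier_expand[OF f tensor_space_partD[OF x]] by metis
      then obtain w where "w \<in> words m n r" "x w * f (basis_tensor w) u \<noteq> 0"
        by (meson sum.neutral)
      then show ?thesis
        using assms(2)[of w] x by (auto simp: tensor_space_part_def)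
    qed
    then show ?thesis
      using End_carrier_maps[OF f tensor_space_partD[OF x]] by (auto simp: tensor_space_part_def)
  qed
  then show ?thesis using f by (simp add: hpart_End_alg)
qed

lemma hpart_one: "\<one>\<^bsub>End_alg m n r\<^esub> \<in> hpart (End_alg m n r) 0"
  by (auto simp: hpart_End_alg End_carrier_one tensor_space_partD) (auto simp: End_alg_def
        End_carrier_one tensor_space_partD)

lemma hpart_zero: "\<zero>\<^bsub>End_alg m n r\<^esub> \<in> hpart (End_alg m n r) i"
  by (auto simp: hpart_End_alg)
     (auto simp: End_alg_def End_carrier_zero tensor_space_partD tensor_space_part_zero)

lemma hpart_add:
  "f \<in> hpart (End_alg m n r) i \<Longrightarrow> g \<in> hpart (End_alg m n r) i \<Longrightarrow>
    f \<oplus>\<^bsub>End_alg m n r\<^esub> g \<in> hpart (End_alg m n r) i"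
  by (simp add: hpart_End_alg)
     (simp add: End_alg_def End_carrier_plus tensor_space_partD tensor_space_part_add)

lemma hpart_mult:
  "f \<in> hpart (End_alg m n r) i \<Longrightarrow> g \<in> hpart (End_alg m n r) j \<Longrightarrow>
    f \<otimes>\<^bsub>End_alg m n r\<^esub> g \<in> hpart (End_alg m n r) (i + j)"
  by (simp add: hpart_End_alg)
     (simp add: End_alg_def End_carrier_compose tensor_space_partD compose_eq add.assoc)

text \<open>
  The image of a basis tensor would have to be supported on words of two different parities at once.
\<close>

lemma hpart_disjoint:
  assumes f0: "f \<in> hpart (End_alg m n r) 0" and f1: "f \<in> hpart (End_alg m n r) 1"
  shows "f = \<zero>\<^bsub>End_alg m n r\<^esub>"
proof -
  have "f (basis_tensor w) u = 0" if "w \<in> words m n r" for w u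
    using hpart_maps[OF f0 basis_tensor_part[OF that]] hpart_maps[OF f1 basis_tensor_part[OF that]]
    by (cases "word_par m w") (auto simp: tensor_space_part_def)
  then have "f x = (\<lambda>u. 0)" if "x \<in> tensor_space m n r" for x
    using End_carrier_expand[OF hpart_carrier[OF f0] that] by simp
  then show ?thesis
    by (intro End_carrier_eqI[OF hpart_carrier[OF f0] hpart_carrier[OF hpart_zero]])
       (simp add: End_alg_def)
qed


section \<open>Parity and weights of the generators\<close>

lemma lin_ext_carrier:
  assumes "\<And>w. w \<in> words m n r \<Longrightarrow> h w \<in> tensor_space m n r"
  shows "lin_ext m n r h \<in> End_carrier m n r"
  using assms
  by (intro End_carrierI)
     (auto simp: lin_ext_def tensor_space_add tensor_space_scale tensor_space_sum
        sum.distrib sum_distrib_left algebra_simps)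

lemma lin_ext_basis:
  "w \<in> words m n r \<Longrightarrow> lin_ext m n r h (basis_tensor w) = h w"
  by (auto simp: lin_ext_def basis_tensor_space)
     (auto simp: basis_tensor_def finite_words if_distrib[of "\<lambda>x. x * _"] cong: if_cong)

lemma lin_ext_hpart:
  assumes "\<And>w. w \<in> words m n r \<Longrightarrow> h w \<in> tensor_space_part m n r (i + word_par m w)"
  shows "lin_ext m n r h \<in> hpart (End_alg m n r) i"
  by (intro hpartI_basis lin_ext_carrier tensor_space_partD[OF assms])
     (simp_all add: lin_ext_basis assms)

lemma words_Suc_cases:
  assumes "w \<in> words m n (Suc r)"
  obtains a u where "w = a # u" "[a] \<in> words m n 1" "u \<in> words m n r" "a \<in> {1..m + n}"
  using assms by (cases w) (auto simp: words_def)

lemma tensor_vec_part: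
  assumes x: "x \<in> tensor_space_part m n 1 i" and y: "y \<in> tensor_space_part m n r j"
  shows "tensor_vec x y \<in> tensor_space_part m n (Suc r) (i + j)"
proof -
  have *: "u \<in> words m n (Suc r) \<and> word_par m u = i + j" if nz: "tensor_vec x y u \<noteq> 0" for u
  proof -
    obtain a u' where u: "u = a # u'" "x [a] \<noteq> 0" "y u' \<noteq> 0"
      using nz by (auto simp: tensor_vec_def split: list.splits)
    have "[a] \<in> words m n 1" "u' \<in> words m n r" "word_par m [a] = i" "word_par m u' = j"
      using x y u by (auto simp: tensor_space_part_def tensor_space_def)
    then show ?thesis
      by (auto simp: u words_def word_par_def)
  qed
  then show ?thesis
    by (auto simp: tensor_space_part_def tensor_space_def)
qed

text \<open>
  Parities of operators add up under the tensor product, because those of words do under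
  concatenation; the super sign only rescales the image of each basis tensor.
\<close>

lemma tensor_opr_hpart:
  assumes f: "f \<in> hpart (End_alg m n 1) i" and g: "g \<in> hpart (End_alg m n r) j"
  shows "tensor_opr m n r p f g \<in> hpart (End_alg m n (Suc r)) (i + j)"
  unfolding tensor_opr_def
proof (intro lin_ext_hpart tensor_space_part_scale)
  fix w assume "w \<in> words m n (Suc r)"
  then obtain a u where w: "w = a # u" "[a] \<in> words m n 1" "u \<in> words m n r"
    by (rule words_Suc_cases)
  have par: "i + word_par m [a] + (j + word_par m u) = i + j + word_par m w"
    by (simp add: w word_par_def algebra_simps)
  then show "tensor_vec (f (basis_tensor [hd w])) (g (basis_tensor (tl w)))
      \<in> tensor_space_part m n (Suc r) (i + j + word_par m w)"
    using tensor_vec_part[OF hpart_maps[OF f basis_tensor_part[OF w(2)]]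
        hpart_maps[OF g basis_tensor_part[OF w(3)]]]
    unfolding par by (simp add: w(1))
qed

text \<open>
  \<open>E\<^sub>a\<close> replaces the letter \<open>a + 1\<close> by \<open>a\<close>, and \<open>F\<^sub>a\<close> replaces \<open>a\<close> by \<open>a + 1\<close>; the two letters have
  different parities exactly for \<open>a = m\<close>.
\<close>

lemma vec_act_part:
  assumes "g \<in> generators m n" and "[b] \<in> words m n 1"
  shows "vec_act m g b \<in> tensor_space_part m n 1 (gen_par m g + word_par m [b])"
  using assms
  by (cases g)
     (auto simp: generators_def words_def word_par_def par_def tensor_space_part_def
        tensor_space_def basis_tensor_def)

lemma act1_hpart:
  assumes "g \<in> generators m n"
  shows "act1 m n g \<in> hpart (End_alg m n 1) (gen_par m g)"
  unfolding act1_def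
proof (rule lin_ext_hpart)
  fix w assume "w \<in> words m n 1"
  then obtain b where "w = [b]" by (auto simp: words_def length_Suc_conv)
  with \<open>w \<in> words m n 1\<close> assms vec_act_part[of g m n b]
  show "vec_act m g (hd w) \<in> tensor_space_part m n 1 (gen_par m g + word_par m w)"
    by simp
qed

lemma generators_neighbours:
  "E a \<in> generators m n \<or> F a \<in> generators m n \<Longrightarrow>
    {K a, Kinv a, K (a + 1), Kinv (a + 1)} \<subseteq> generators m n"
  by (auto simp: generators_def)

text \<open>
  In each of the two summands of the coproduct of \<open>E\<^sub>a\<close> or \<open>F\<^sub>a\<close> one tensor factor is the generator
  itself and the other one is a product of even elements, so both summands have the parity of the
  generator.
\<close>

lemma act_hpart:
  assumes "g \<in> generators m n" "r \<ge> 1"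
  shows "act m n r g \<in> hpart (End_alg m n r) (gen_par m g)"
  using assms(2,1)
proof (induction r arbitrary: g rule: nat_induct_at_least)
  case base
  then show ?case using act1_hpart by simp
next
  case (Suc r)
  then obtain k where r: "r = Suc k" by (cases r) auto
  show ?case
  proof (cases g)
    case (E a)
    have "K (a + 1) \<in> generators m n" "Kinv a \<in> generators m n"
      using generators_neighbours[of a m n] Suc.prems E by auto
    then have "act m n r (Kinv a) \<otimes>\<^bsub>End_alg m n r\<^esub> act m n r (K (a + 1)) \<in> hpart (End_alg m n r) 0"
      using hpart_mult[OF Suc.IH Suc.IH] by fastforce
    from tensor_opr_hpart[OF act1_hpart this, of g 0]
      tensor_opr_hpart[OF hpart_one Suc.IH, of g "gen_par m g"]
    show ?thesis using Suc.prems unfolding r E by (simp add: hpart_add)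
  next
    case (F a)
    have "Kinv (a + 1) \<in> generators m n" "K a \<in> generators m n"
      using generators_neighbours[of a m n] Suc.prems F by auto
    then have "act1 m n (K a) \<otimes>\<^bsub>End_alg m n 1\<^esub> act1 m n (Kinv (a + 1)) \<in> hpart (End_alg m n 1) 0"
      using hpart_mult[OF act1_hpart act1_hpart] by fastforce
    from tensor_opr_hpart[OF this Suc.IH, of g "gen_par m g"]
      tensor_opr_hpart[OF act1_hpart hpart_one, of g m n r 0]
    show ?thesis using Suc.prems unfolding r F by (simp add: hpart_add)
  next
    case (K a)
    from tensor_opr_hpart[OF act1_hpart Suc.IH, of g g 0] Suc.prems
    show ?thesis unfolding r K by simp
  next
    case (Kinv a)
    from tensor_opr_hpart[OF act1_hpart Suc.IH, of g g 0] Suc.prems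
    show ?thesis unfolding r Kinv by simp
  qed
qed

lemma act_K_basis:
  assumes "r \<ge> 1" "w \<in> words m n r"
  shows "act m n r (K a) (basis_tensor w) = (\<lambda>u. vpar m a ^ count_list w a * basis_tensor w u)"
  using assms
proof (induction r arbitrary: w rule: nat_induct_at_least)
  case base
  then obtain b where "w = [b]" by (auto simp: words_def length_Suc_conv)
  with base show ?case by (auto simp: act1_def lin_ext_basis)
next
  case (Suc r)
  then obtain k where r: "r = Suc k" by (cases r) auto
  obtain b u where w: "w = b # u" "[b] \<in> words m n 1" "u \<in> words m n r"
    using Suc.prems by (rule words_Suc_cases)
  have "act m n (Suc r) (K a) (basis_tensor w)
      = tensor_vec (act1 m n (K a) (basis_tensor [b])) (act m n r (K a) (basis_tensor u))"
    using Suc.prems by (simp add: r tensor_opr_def lin_ext_basis w(1) par_sign_def)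
  also have "\<dots> = tensor_vec (vec_act m (K a) b)
      (\<lambda>t. vpar m a ^ count_list u a * basis_tensor u t)"
    using Suc.IH[OF w(3)] w(2) by (simp add: act1_def lin_ext_basis)
  also have "\<dots> = (\<lambda>u. vpar m a ^ count_list w a * basis_tensor w u)"
    by (auto simp: fun_eq_iff tensor_vec_def w basis_tensor_def split: list.splits)
  finally show ?case .
qed

lemma act_K_apply:
  assumes "r \<ge> 1" "a \<in> {1..m + n}" and x: "x \<in> tensor_space m n r"
  shows "act m n r (K a) x = (\<lambda>u. vpar m a ^ count_list u a * x u)"
proof
  fix u
  have "act m n r (K a) \<in> End_carrier m n r"
    using assms by (intro hpart_carrier[OF act_hpart]) (auto simp: generators_def)
  from End_carrier_expand[OF this x]
  have "act m n r (K a) x u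
      = (\<Sum>w\<in>words m n r. x w * act m n r (K a) (basis_tensor w) u)"
    by simp
  also have "\<dots> = (\<Sum>w\<in>words m n r. if w = u then x w * vpar m a ^ count_list w a else 0)"
    using assms by (intro sum.cong) (simp_all add: act_K_basis, simp add: basis_tensor_def)
  also have "\<dots> = vpar m a ^ count_list u a * x u"
    using x by (simp add: finite_words tensor_space_def)
  finally show "act m n r (K a) x u = vpar m a ^ count_list u a * x u" .
qed


section \<open>Operators commuting with the torus\<close>

text \<open>The powers of \<open>v\<close> are told apart by the degrees of the corresponding monomials.\<close>

lemma vv_power: "vv ^ k = Fraction_Field.Fract (monom 1 k) 1"
proof (induction k)
  case 0
  then show ?case by (simp add: One_fract_def)
next
  case (Suc k)
  then show ?case by (simp add: vv_def monom_Suc)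
qed

lemma vpar_power_inject: "vpar m a ^ k = vpar m a ^ l \<longleftrightarrow> k = l"
proof -
  have "vv ^ k = vv ^ l \<longleftrightarrow> k = l"
    by (auto simp: vv_power eq_fract dest: arg_cong[of "monom 1 k :: complex poly" _ degree]
        simp: degree_monom_eq)
  then show ?thesis by (simp add: vpar_def power_inverse)
qed

text \<open>Words of equal weight are rearrangements of each other, and parity is a sum over the letters.\<close>

lemma word_par_eqI:
  assumes "w \<in> words m n r" "u \<in> words m n r"
    and "\<And>a. a \<in> {1..m + n} \<Longrightarrow> count_list w a = count_list u a"
  shows "word_par m w = word_par m u"
proof -
  have "count_list w a = count_list u a" for a
  proof (cases "a \<in> {1..m + n}")
    case False
    then have "a \<notin> set w" "a \<notin> set u" using assms by (auto simp: words_def)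
    then show ?thesis by (metis count_list_0_iff)
  qed (use assms in auto)
  then have "mset w = mset u" by (simp add: multiset_eq_iff flip: count_mset)
  then show ?thesis unfolding word_par_def by (metis mset_map sum_mset_sum_list)
qed

text \<open>
  Comparing the coefficients at \<open>u\<close> of \<open>z (K\<^sub>a e\<^sub>w)\<close> and \<open>K\<^sub>a (z e\<^sub>w)\<close> shows that a word \<open>u\<close> occurs in
  \<open>z e\<^sub>w\<close> only if it has the same weight as \<open>w\<close>.
\<close>

lemma even_if_commutes_with_K:
  assumes r: "r \<ge> 1" and z: "z \<in> End_carrier m n r"
    and comm: "\<And>a. a \<in> {1..m + n} \<Longrightarrow>
      z \<otimes>\<^bsub>End_alg m n r\<^esub> act m n r (K a) = act m n r (K a) \<otimes>\<^bsub>End_alg m n r\<^esub> z"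
  shows "z \<in> hpart (End_alg m n r) 0"
proof (rule hpartI_basis[OF z])
  fix w assume w: "w \<in> words m n r"
  note b = basis_tensor_space[OF w]
  note zb = End_carrier_maps[OF z b]
  have "word_par m u = word_par m w" if nz: "z (basis_tensor w) u \<noteq> 0" for u
  proof (rule word_par_eqI)
    show "u \<in> words m n r" using zb nz by (auto simp: tensor_space_def)
    fix a assume a: "a \<in> {1..m + n}"
    have "z (act m n r (K a) (basis_tensor w)) = act m n r (K a) (z (basis_tensor w))"
      using fun_cong[OF comm[OF a], of "basis_tensor w"] b by (simp add: End_alg_def compose_def)
    then have "vpar m a ^ count_list w a * z (basis_tensor w) u
        = vpar m a ^ count_list u a * z (basis_tensor w) u"
      using act_K_basis[OF r w] act_K_apply[OF r a zb] End_carrier_scale[OF z b] by metis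
    then show "count_list u a = count_list w a"
      using nz by (simp add: vpar_power_inject)
  qed (rule w)
  then show "z (basis_tensor w) \<in> tensor_space_part m n r (0 + word_par m w)"
    using zb by (auto simp: tensor_space_part_def)
qed


section \<open>Center and supercenter of the quantum Schur superalgebra\<close>

lemma schur_superalgebra_simps:
  "carrier (schur_superalgebra m n r) = subalgebra_gen (End_alg m n r) (act m n r ` generators m n)"
  "hpart (schur_superalgebra m n r) i =
     hpart (End_alg m n r) i \<inter> carrier (schur_superalgebra m n r)"
  "f \<otimes>\<^bsub>schur_superalgebra m n r\<^esub> g = f \<otimes>\<^bsub>End_alg m n r\<^esub> g"
  "f \<oplus>\<^bsub>schur_superalgebra m n r\<^esub> g = f \<oplus>\<^bsub>End_alg m n r\<^esub> g"
  "c \<odot>\<^bsub>schur_superalgebra m n r\<^esub> f = c \<odot>\<^bsub>End_alg m n r\<^esub> f"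
  by (simp_all add: schur_superalgebra_def)

lemma subalgebra_gen_carrier:
  assumes "a \<in> subalgebra_gen (End_alg m n r) G" and "G \<subseteq> End_carrier m n r"
  shows "a \<in> End_carrier m n r"
  using assms
  by (induction rule: subalgebra_gen.induct)
     (auto simp: End_alg_def End_carrier_one End_carrier_smult End_carrier_plus End_carrier_compose)

lemma schur_carrier:
  assumes "r \<ge> 1" "a \<in> carrier (schur_superalgebra m n r)"
  shows "a \<in> End_carrier m n r"
proof (rule subalgebra_gen_carrier)
  show "a \<in> subalgebra_gen (End_alg m n r) (act m n r ` generators m n)"
    using assms(2) by (simp add: schur_superalgebra_simps)
qed (use act_hpart hpart_carrier assms(1) in blast)

lemma End_alg_smult_one: "f \<in> End_carrier m n r \<Longrightarrow> 1 \<odot>\<^bsub>End_alg m n r\<^esub> f = f"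
  by (rule extensionalityI[of _ "tensor_space m n r"])
     (auto simp: End_alg_def End_carrier_extensional)

lemma End_alg_add_zero:
  "f \<in> End_carrier m n r \<Longrightarrow> f \<oplus>\<^bsub>End_alg m n r\<^esub> \<zero>\<^bsub>End_alg m n r\<^esub> = f"
  by (rule extensionalityI[of _ "tensor_space m n r"])
     (auto simp: End_alg_def End_carrier_extensional)

lemma End_alg_zero_mult:
  assumes f: "f \<in> End_carrier m n r"
  shows "\<zero>\<^bsub>End_alg m n r\<^esub> \<otimes>\<^bsub>End_alg m n r\<^esub> f = c \<odot>\<^bsub>End_alg m n r\<^esub> (f \<otimes>\<^bsub>End_alg m n r\<^esub> \<zero>\<^bsub>End_alg m n r\<^esub>)"
proof -
  have "f (\<lambda>u. 0) = (\<lambda>u. 0)"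
    using End_carrier_scale[OF f tensor_space_zero, of 0] by simp
  then show ?thesis
    using End_carrier_maps[OF f] by (auto simp: End_alg_def compose_def fun_eq_iff)
qed

lemma zero_in_schur: "\<zero>\<^bsub>End_alg m n r\<^esub> \<in> carrier (schur_superalgebra m n r)"
proof -
  have "\<zero>\<^bsub>End_alg m n r\<^esub> = 0 \<odot>\<^bsub>End_alg m n r\<^esub> \<one>\<^bsub>End_alg m n r\<^esub>"
    by (auto simp: End_alg_def)
  then show ?thesis
    by (metis schur_superalgebra_simps(1) subalgebra_gen.one subalgebra_gen.smult)
qed

text \<open>The commutant of an operator is a unital subalgebra.\<close>

lemma commutes_with_subalgebra_gen:
  assumes "a \<in> subalgebra_gen (End_alg m n r) G" and G: "G \<subseteq> End_carrier m n r"
    and z: "z \<in> End_carrier m n r"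
    and comm: "\<And>g. g \<in> G \<Longrightarrow> z \<otimes>\<^bsub>End_alg m n r\<^esub> g = g \<otimes>\<^bsub>End_alg m n r\<^esub> z"
  shows "z \<otimes>\<^bsub>End_alg m n r\<^esub> a = a \<otimes>\<^bsub>End_alg m n r\<^esub> z"
proof -
  have iff: "z \<otimes>\<^bsub>End_alg m n r\<^esub> f = f \<otimes>\<^bsub>End_alg m n r\<^esub> z \<longleftrightarrow>
      (\<forall>x\<in>tensor_space m n r. z (f x) = f (z x))" for f
    by (auto simp: End_alg_def compose_def fun_eq_iff restrict_def)
  note maps = End_carrier_maps[OF z] End_carrier_maps[OF subalgebra_gen_carrier[OF _ G]]
  show ?thesis
    using assms(1)
  proof (induction rule: subalgebra_gen.induct)
    case (gen g)
    then show ?case by (rule comm)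
  next
    case one
    then show ?case
      unfolding iff using maps by (auto simp: End_alg_def)
  next
    case (smult x c)
    then show ?case
      unfolding iff using maps End_carrier_scale[OF z] by (auto simp: End_alg_def)
  next
    case (add x y)
    then show ?case
      unfolding iff using maps End_carrier_add[OF z] by (auto simp: End_alg_def)
  next
    case (mult x y)
    then show ?case
      unfolding iff using maps by (auto simp: End_alg_def compose_def)
  qed
qed

lemma act_in_schur:
  "g \<in> generators m n \<Longrightarrow> act m n r g \<in> carrier (schur_superalgebra m n r)"
  by (auto simp: schur_superalgebra_simps intro: subalgebra_gen.gen)

lemma act_schur_hpart:
  "g \<in> generators m n \<Longrightarrow> r \<ge> 1 \<Longrightarrow> act m n r g \<in> hpart (schur_superalgebra m n r) (gen_par m g)"
  using act_in_schur act_hpart by (auto simp: schur_superalgebra_simps(2))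

lemma center_even:
  assumes r: "r \<ge> 1" and z: "z \<in> alg_center (schur_superalgebra m n r)"
  shows "z \<in> hpart (schur_superalgebra m n r) 0"
proof -
  have zc: "z \<in> carrier (schur_superalgebra m n r)"
    using z by (simp add: alg_center_def)
  have "z \<in> hpart (End_alg m n r) 0"
  proof (rule even_if_commutes_with_K[OF r schur_carrier[OF r zc]])
    fix a assume "a \<in> {1..m + n}"
    then have "act m n r (K a) \<in> carrier (schur_superalgebra m n r)"
      by (intro act_in_schur) (auto simp: generators_def)
    then show "z \<otimes>\<^bsub>End_alg m n r\<^esub> act m n r (K a) = act m n r (K a) \<otimes>\<^bsub>End_alg m n r\<^esub> z"
      using z by (simp add: alg_center_def schur_superalgebra_simps(3))
  qed
  with zc show ?thesis by (simp add: schur_superalgebra_simps(2))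
qed

text \<open>
  The sign in the definition is trivial on even elements. What remains is that commuting with
  homogeneous elements implies commuting with all elements: it suffices to check the generators, and
  these are homogeneous.
\<close>

lemma supercenter_even_part:
  assumes r: "r \<ge> 1"
  shows "supercenter_part (schur_superalgebra m n r) 0 = alg_center (schur_superalgebra m n r)"
    (is "?L = ?R")
proof
  show "?L \<subseteq> ?R"
  proof
    fix z assume z: "z \<in> ?L"
    then have zc: "z \<in> carrier (schur_superalgebra m n r)"
      by (simp add: supercenter_part_def schur_superalgebra_simps(2))
    have G: "act m n r ` generators m n \<subseteq> End_carrier m n r"
      using act_hpart[OF _ r] hpart_carrier by blast
    have comm: "z \<otimes>\<^bsub>End_alg m n r\<^esub> g = g \<otimes>\<^bsub>End_alg m n r\<^esub> z"
      if g: "g \<in> act m n r ` generators m n" for g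
    proof -
      have "g \<otimes>\<^bsub>End_alg m n r\<^esub> z \<in> End_carrier m n r"
        using G g schur_carrier[OF r zc] by (auto simp: End_alg_def intro: End_carrier_compose)
      moreover obtain j where "g \<in> hpart (schur_superalgebra m n r) j"
        using g act_schur_hpart[OF _ r] by blast
      ultimately show ?thesis
        using z by (auto simp: supercenter_part_def par_sign_def schur_superalgebra_simps(3,5)
            End_alg_smult_one)
    qed
    show "z \<in> ?R"
      using commutes_with_subalgebra_gen[OF _ G schur_carrier[OF r zc] comm] zc
      by (simp add: alg_center_def schur_superalgebra_simps(1,3))
  qed
next
  show "?R \<subseteq> ?L"
  proof
    fix z assume z: "z \<in> ?R"
    then have zc: "z \<in> End_carrier m n r"
      using schur_carrier[OF r] by (simp add: alg_center_def)
    have "z \<otimes>\<^bsub>End_alg m n r\<^esub> a = 1 \<odot>\<^bsub>End_alg m n r\<^esub> (a \<otimes>\<^bsub>End_alg m n r\<^esub> z)"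
      if a: "a \<in> carrier (schur_superalgebra m n r)" for a
    proof -
      have "a \<otimes>\<^bsub>End_alg m n r\<^esub> z \<in> End_carrier m n r"
        using schur_carrier[OF r a] zc by (simp add: End_alg_def End_carrier_compose)
      then show ?thesis
        using z a by (simp add: alg_center_def End_alg_smult_one schur_superalgebra_simps(3))
    qed
    then show "z \<in> ?L"
      using center_even[OF r z]
      by (simp add: supercenter_part_def par_sign_def schur_superalgebra_simps(2,3,5))
  qed
qed

text \<open>An odd element supercommuting with the even \<open>K\<^sub>a\<close> commutes with them, hence is also even.\<close>

lemma supercenter_odd_part:
  assumes r: "r \<ge> 1"
  shows "supercenter_part (schur_superalgebra m n r) 1 = {\<zero>\<^bsub>End_alg m n r\<^esub>}"
proof (intro subset_antisym subsetI)
  fix z assume z: "z \<in> supercenter_part (schur_superalgebra m n r) 1"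
  then have odd: "z \<in> hpart (End_alg m n r) 1"
    by (simp add: supercenter_part_def schur_superalgebra_simps(2))
  note zc = hpart_carrier[OF odd]
  have "z \<in> hpart (End_alg m n r) 0"
  proof (rule even_if_commutes_with_K[OF r zc])
    fix a assume "a \<in> {1..m + n}"
    then have g: "K a \<in> generators m n" by (simp add: generators_def)
    have "act m n r (K a) \<otimes>\<^bsub>End_alg m n r\<^esub> z \<in> End_carrier m n r"
      using hpart_carrier[OF act_hpart[OF g r]] zc by (simp add: End_alg_def End_carrier_compose)
    moreover have "act m n r (K a) \<in> hpart (schur_superalgebra m n r) 0"
      using act_schur_hpart[OF g r] by simp
    ultimately show "z \<otimes>\<^bsub>End_alg m n r\<^esub> act m n r (K a) = act m n r (K a) \<otimes>\<^bsub>End_alg m n r\<^esub> z"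
      using z by (auto simp: supercenter_part_def par_sign_def schur_superalgebra_simps(3,5)
          End_alg_smult_one)
  qed
  with odd show "z \<in> {\<zero>\<^bsub>End_alg m n r\<^esub>}" using hpart_disjoint by blast
next
  fix z assume "z \<in> {\<zero>\<^bsub>End_alg m n r\<^esub>}"
  then show "z \<in> supercenter_part (schur_superalgebra m n r) 1"
    using hpart_zero[of m n r 1] zero_in_schur[of m n r] End_alg_zero_mult schur_carrier[OF r]
    by (auto simp: supercenter_part_def schur_superalgebra_simps(2,3,5))
qed

theorem corollary4p2:
  fixes m n r :: nat
  assumes "m \<ge> 1" and "n \<ge> 1" and "r \<ge> 1"
  shows "alg_center (schur_superalgebra m n r) \<subseteq> hpart (schur_superalgebra m n r) 0 \<and>
         supercenter (schur_superalgebra m n r) = alg_center (schur_superalgebra m n r)"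
proof
  show "alg_center (schur_superalgebra m n r) \<subseteq> hpart (schur_superalgebra m n r) 0"
    using center_even[OF \<open>r \<ge> 1\<close>] by blast
  have "z \<oplus>\<^bsub>End_alg m n r\<^esub> \<zero>\<^bsub>End_alg m n r\<^esub> = z"
    if "z \<in> alg_center (schur_superalgebra m n r)" for z
    using that schur_carrier[OF \<open>r \<ge> 1\<close>] by (simp add: alg_center_def End_alg_add_zero)
  then show "supercenter (schur_superalgebra m n r) = alg_center (schur_superalgebra m n r)"
    unfolding supercenter_def supercenter_even_part[OF \<open>r \<ge> 1\<close>] supercenter_odd_part[OF \<open>r \<ge> 1\<close>]
    by (auto simp: schur_superalgebra_simps(4)) metis
qed

end
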